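(* Let $L$ be an involutive division on $\mathbb{M}$ and $\succ$ an admissible monomial ordering. Every $L$-involutive basis $F\subset R$ is a Gröbner basis (of the ideal $Id(F)$ with respect to $\succ$).
   Context: $R=K[x_1,\dots,x_n]$ with $K$ a field of characteristic zero; $\mathbb{M}$ is the monoid of monomials; $Id(F)$ is the ideal of $R$ generated by $F$. $\succ$ is an admissible monomial ordering with $x_1\succ\cdots\succ x_n$; $lt(f)$, $lc(f)$, $lm(f)=lt(f)/lc(f)$ are the leading term, leading coefficient and leading monomial of $f$; $lm(F)=\{lm(f)\mid f\in F\}$. Involutive division: $L$ is given if for any finite $U\subset\mathbb{M}$ and any $u\in U$ there is given a submonoid $L(u,U)$ of $\mathbb{M}$ such that (a) if $w\in L(u,U)$ and $v\mid w$, then $v\in L(u,U)$; (b) if $u,v\in U$ and $uL(u,U)\cap vL(v,U)\ne\emptyset$, then $u\in vL(v,U)$ or $v\in uL(u,U)$; (c) if $v\in U$ and $v\in uL(u,U)$, then $L(v,U)\subseteq L(u,U)$; (d) if $V\subseteq U$, then $L(u,U)\subseteq L(u,V)$ for all $u\in V$. For $u\in U$, $u|_L w$ means $w\in uL(u,U)$. $C_L(U)=\bigcup_{u\in U}uL(u,U)$. $U$ is $L$-autoreduced if no element of $U$ is $L$-divisible (w.r.t. $U$) by another element of $U$. $L$-autoreduced polynomial set: a finite set $F$ of nonzero polynomials with pairwise distinct leading monomials such that $lm(F)$ is $L$-autoreduced and no $f\in F$ has a term with nonzero coefficient, other than $lt(f)$, whose monomial lies in $C_L(lm(F))$. Involutive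 reduction: $p$ is $L$-reducible modulo $f\in F$ if $p$ has a term $a\,u$ ($a\in K$, $a\neq0$, $u\in\mathbb{M}$) with $u=lm(f)v$, $v\in L(lm(f),lm(F))$; the corresponding $L$-reduction is $p\to p-(a/lc(f))\,f v$. $p$ is in $L$-normal form modulo $F$ if it is not $L$-reducible modulo any $f\in F$. $NF_L(p,F)$ denotes an $L$-normal form of $p$ modulo $F$, i.e. a polynomial in $L$-normal form modulo $F$ obtained from $p$ by a finite chain of $L$-reductions modulo $F$, chosen by an arbitrary fixed algorithm. $L$-involutive basis: an $L$-autoreduced set $F$ is an $L$-involutive basis of $Id(F)$ if $NF_L(fu,F)=0$ for all $f\in F$ and all $u\in\mathbb{M}$. *)

theory Defs
  imports Complex_Main "HOL-Library.Poly_Mapping"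
begin

text \<open>
  Monomials in the variables \<open>x\<^sub>i\<close>, \<open>i :: 'n\<close>, are exponent vectors, so the monoid of monomials
  is written additively: \<open>0\<close> is the monomial 1, \<open>u + v\<close> is the product, and
  \<open>Poly_Mapping.single i 1\<close> is \<open>x\<^sub>i\<close>. The term \<open>a u\<close> is the polynomial \<open>Poly_Mapping.single u a\<close>,
  and \<open>Poly_Mapping.keys p\<close> is the set of monomials occurring in \<open>p\<close> with nonzero coefficient.
\<close>

type_synonym 'n monom = "'n \<Rightarrow>\<^sub>0 nat"
type_synonym ('n, 'k) mpoly = "'n monom \<Rightarrow>\<^sub>0 'k"

text \<open>The ideal \<open>Id(F)\<close> generated by \<open>F\<close> is the span of \<open>F\<close> in the ring regarded as a module over itself.\<close>

lemma module_times: "module ((*) :: 'a::comm_ring_1 \<Rightarrow> 'a \<Rightarrow> 'a)"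
  by unfold_locales (simp_all add: algebra_simps)

definition ideal :: "('n, 'k::field) mpoly set \<Rightarrow> ('n, 'k) mpoly set" where
  "ideal F = module.span (*) F"

definition mdvd :: "'n monom \<Rightarrow> 'n monom \<Rightarrow> bool" where
  "mdvd v w \<longleftrightarrow> (\<exists>t. w = v + t)"

text \<open>
  \<open>gt u v\<close> stands for \<open>u \<succ> v\<close>. The variables are numbered by the linear order of the finite
  index type, so that \<open>x\<^sub>1 \<succ> \<dots> \<succ> x\<^sub>n\<close> is the last conjunct.
\<close>

definition admissible :: "(('n::{finite,linorder}) monom \<Rightarrow> 'n monom \<Rightarrow> bool) \<Rightarrow> bool" where
  "admissible gt \<longleftrightarrow>
     irreflp gt \<and> transp gt \<and> totalp gt \<and>
     (\<forall>u. u \<noteq> 0 \<longrightarrow> gt u 0) \<and>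
     (\<forall>u v w. gt u v \<longrightarrow> gt (u + w) (v + w)) \<and>
     (\<forall>i j. i < j \<longrightarrow> gt (Poly_Mapping.single i 1) (Poly_Mapping.single j 1))"

text \<open>Leading data are only meaningful for nonzero polynomials.\<close>

definition lm :: "('n monom \<Rightarrow> 'n monom \<Rightarrow> bool) \<Rightarrow> ('n, 'k::field) mpoly \<Rightarrow> 'n monom" where
  "lm gt f = (THE u. u \<in> Poly_Mapping.keys f \<and> (\<forall>v\<in>Poly_Mapping.keys f. v \<noteq> u \<longrightarrow> gt u v))"

definition lc :: "('n monom \<Rightarrow> 'n monom \<Rightarrow> bool) \<Rightarrow> ('n, 'k::field) mpoly \<Rightarrow> 'k" where
  "lc gt f = Poly_Mapping.lookup f (lm gt f)"

definition lt :: "('n monom \<Rightarrow> 'n monom \<Rightarrow> bool) \<Rightarrow> ('n, 'k::field) mpoly \<Rightarrow> ('n, 'k) mpoly" where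
  "lt gt f = Poly_Mapping.single (lm gt f) (lc gt f)"

definition groebner_basis ::
    "('n monom \<Rightarrow> 'n monom \<Rightarrow> bool) \<Rightarrow> ('n, 'k::field) mpoly set \<Rightarrow> ('n, 'k) mpoly set \<Rightarrow> bool" where
  "groebner_basis gt G I \<longleftrightarrow>
     finite G \<and> G \<subseteq> I \<and> ideal (lt gt ` (G - {0})) = ideal (lt gt ` (I - {0}))"

definition submonoid :: "'n monom set \<Rightarrow> bool" where
  "submonoid S \<longleftrightarrow> 0 \<in> S \<and> (\<forall>u\<in>S. \<forall>v\<in>S. u + v \<in> S)"

text \<open>\<open>cone L u U\<close> is \<open>u L(u,U)\<close>.\<close>

definition cone :: "('n monom \<Rightarrow> 'n monom set \<Rightarrow> 'n monom set) \<Rightarrow>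
    'n monom \<Rightarrow> 'n monom set \<Rightarrow> 'n monom set" where
  "cone L u U = {u + w |w. w \<in> L u U}"

definition involutive_division ::
    "('n monom \<Rightarrow> 'n monom set \<Rightarrow> 'n monom set) \<Rightarrow> bool" where
  "involutive_division L \<longleftrightarrow>
     (\<forall>U. finite U \<longrightarrow>
        (\<forall>u\<in>U. submonoid (L u U)) \<and>
        (\<forall>u\<in>U. \<forall>w\<in>L u U. \<forall>v. mdvd v w \<longrightarrow> v \<in> L u U) \<and>
        (\<forall>u\<in>U. \<forall>v\<in>U. cone L u U \<inter> cone L v U \<noteq> {} \<longrightarrow> u \<in> cone L v U \<or> v \<in> cone L u U) \<and>
        (\<forall>u\<in>U. \<forall>v\<in>U. v \<in> cone L u U \<longrightarrow> L v U \<subseteq> L u U) \<and>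
        (\<forall>V. V \<subseteq> U \<longrightarrow> (\<forall>u\<in>V. L u U \<subseteq> L u V)))"

definition C_L ::
    "('n monom \<Rightarrow> 'n monom set \<Rightarrow> 'n monom set) \<Rightarrow> 'n monom set \<Rightarrow> 'n monom set" where
  "C_L L U = (\<Union>u\<in>U. cone L u U)"

definition autoreduced_monoms ::
    "('n monom \<Rightarrow> 'n monom set \<Rightarrow> 'n monom set) \<Rightarrow> 'n monom set \<Rightarrow> bool" where
  "autoreduced_monoms L U \<longleftrightarrow> (\<forall>u\<in>U. \<forall>v\<in>U. u \<noteq> v \<longrightarrow> u \<notin> cone L v U)"

definition autoreduced ::
    "('n monom \<Rightarrow> 'n monom \<Rightarrow> bool) \<Rightarrow> ('n monom \<Rightarrow> 'n monom set \<Rightarrow> 'n monom set) \<Rightarrow>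
     ('n, 'k::field) mpoly set \<Rightarrow> bool" where
  "autoreduced gt L F \<longleftrightarrow>
     finite F \<and> 0 \<notin> F \<and> inj_on (lm gt) F \<and>
     autoreduced_monoms L (lm gt ` F) \<and>
     (\<forall>f\<in>F. \<forall>u\<in>Poly_Mapping.keys f. u \<noteq> lm gt f \<longrightarrow> u \<notin> C_L L (lm gt ` F))"

definition L_reduction ::
    "('n monom \<Rightarrow> 'n monom \<Rightarrow> bool) \<Rightarrow> ('n monom \<Rightarrow> 'n monom set \<Rightarrow> 'n monom set) \<Rightarrow>
     ('n, 'k::field) mpoly set \<Rightarrow> ('n, 'k) mpoly \<Rightarrow> ('n, 'k) mpoly \<Rightarrow> bool" where
  "L_reduction gt L F p q \<longleftrightarrow>
     (\<exists>f\<in>F. \<exists>u\<in>Poly_Mapping.keys p. \<exists>v\<in>L (lm gt f) (lm gt ` F).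
        u = lm gt f + v \<and>
        q = p - Poly_Mapping.single v (Poly_Mapping.lookup p u / lc gt f) * f)"

definition L_reducible ::
    "('n monom \<Rightarrow> 'n monom \<Rightarrow> bool) \<Rightarrow> ('n monom \<Rightarrow> 'n monom set \<Rightarrow> 'n monom set) \<Rightarrow>
     ('n, 'k::field) mpoly set \<Rightarrow> ('n, 'k) mpoly \<Rightarrow> ('n, 'k) mpoly \<Rightarrow> bool" where
  "L_reducible gt L F f p \<longleftrightarrow> (\<exists>u\<in>Poly_Mapping.keys p. \<exists>v\<in>L (lm gt f) (lm gt ` F). u = lm gt f + v)"

definition L_normal_form ::
    "('n monom \<Rightarrow> 'n monom \<Rightarrow> bool) \<Rightarrow> ('n monom \<Rightarrow> 'n monom set \<Rightarrow> 'n monom set) \<Rightarrow>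
     ('n, 'k::field) mpoly set \<Rightarrow> ('n, 'k) mpoly \<Rightarrow> bool" where
  "L_normal_form gt L F p \<longleftrightarrow> (\<forall>f\<in>F. \<not> L_reducible gt L F f p)"

text \<open>
  \<open>NF p F\<close> plays the role of \<open>NF\<^sub>L(p,F)\<close>. The algorithm computing it is arbitrary but fixed, so it
  is a parameter of the development; its values are only prescribed for \<open>L\<close>-autoreduced \<open>F\<close>.
\<close>

definition normal_form_algorithm ::
    "('n monom \<Rightarrow> 'n monom \<Rightarrow> bool) \<Rightarrow> ('n monom \<Rightarrow> 'n monom set \<Rightarrow> 'n monom set) \<Rightarrow>
     (('n, 'k::field) mpoly \<Rightarrow> ('n, 'k) mpoly set \<Rightarrow> ('n, 'k) mpoly) \<Rightarrow> bool" where
  "normal_form_algorithm gt L NF \<longleftrightarrow>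
     (\<forall>F p. autoreduced gt L F \<longrightarrow>
        (L_reduction gt L F)\<^sup>*\<^sup>* p (NF p F) \<and> L_normal_form gt L F (NF p F))"

definition involutive_basis ::
    "('n monom \<Rightarrow> 'n monom \<Rightarrow> bool) \<Rightarrow> ('n monom \<Rightarrow> 'n monom set \<Rightarrow> 'n monom set) \<Rightarrow>
     (('n, 'k::field) mpoly \<Rightarrow> ('n, 'k) mpoly set \<Rightarrow> ('n, 'k) mpoly) \<Rightarrow>
     ('n, 'k) mpoly set \<Rightarrow> bool" where
  "involutive_basis gt L NF F \<longleftrightarrow>
     autoreduced gt L F \<and> (\<forall>f\<in>F. \<forall>u. NF (f * Poly_Mapping.single u 1) F = 0)"

end

theory Submission
  imports Defs
begin

text \<open>
  What has to be shown is that the leading monomial of every nonzero element of \<open>Id(F)\<close> is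
  divisible by \<open>lm(f)\<close> for some \<open>f \<in> F\<close>, and the reason is a linear one. Consider the
  \<^emph>\<open>prolongations\<close> \<open>f v\<close> with \<open>f \<in> F\<close> and \<open>v \<in> L(lm(f), lm(F))\<close>, so that only multiplicative
  monomials \<open>v\<close> are admitted.

  They span \<open>Id(F)\<close> over the field (\<open>ideal_subset_K_span\<close>): the ideal is spanned by all \<open>f u\<close>, and a
  chain of \<open>L\<close>-reductions from \<open>f u\<close> to \<open>NF(f u, F) = 0\<close> subtracts scalar multiples of prolongations
  only, hence writes \<open>f u\<close> as a linear combination of them.

  Their leading monomials \<open>lm(f) v\<close> are pairwise distinct (\<open>inj_on_lm_prolongations\<close>), because the
  cones \<open>lm(f) L(lm(f), lm(F))\<close> of an \<open>L\<close>-autoreduced set are disjoint.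

  In a linear combination of polynomials with distinct leading monomials the largest of them cannot
  cancel (\<open>lm_in_lm_of_K_span\<close>). So the leading monomial of a nonzero element of \<open>Id(F)\<close> is that of a
  prolongation \<open>f v\<close>, which is a multiple of \<open>lm(f)\<close>.
\<close>

section \<open>Leading monomials\<close>

lemma admissible_irrefl: "admissible gt \<Longrightarrow> \<not> gt u u"
  by (auto simp: admissible_def irreflp_def)

lemma admissible_asym: "admissible gt \<Longrightarrow> gt u v \<Longrightarrow> \<not> gt v u"
  by (metis admissible_def admissible_irrefl transpE)

lemma admissible_has_greatest:
  assumes "admissible gt" "finite A" "A \<noteq> {}"
  shows "\<exists>m\<in>A. \<forall>x\<in>A. x \<noteq> m \<longrightarrow> gt m x"
proof (rule Finite_Set.bex_least_element[OF assms(2)])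
  show "transp_on A gt" "totalp_on A gt"
    using assms(1) by (auto simp: admissible_def intro: transp_on_subset totalp_on_subset)
qed (rule assms(3))

lemma lm_eqI:
  assumes "admissible gt" "u \<in> Poly_Mapping.keys f"
    and "\<And>v. v \<in> Poly_Mapping.keys f \<Longrightarrow> v \<noteq> u \<Longrightarrow> gt u v"
  shows "lm gt f = u"
  unfolding lm_def
proof (rule the_equality)
  fix w assume "w \<in> Poly_Mapping.keys f \<and> (\<forall>v\<in>Poly_Mapping.keys f. v \<noteq> w \<longrightarrow> gt w v)"
  then show "w = u"
    using assms by (metis admissible_asym)
qed (use assms in blast)

lemma lm_greatest_key:
  assumes "admissible gt" "f \<noteq> 0"
  shows "lm gt f \<in> Poly_Mapping.keys f"
    and "v \<in> Poly_Mapping.keys f \<Longrightarrow> v \<noteq> lm gt f \<Longrightarrow> gt (lm gt f) v"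
proof -
  obtain m where m: "m \<in> Poly_Mapping.keys f" "\<forall>v\<in>Poly_Mapping.keys f. v \<noteq> m \<longrightarrow> gt m v"
    using admissible_has_greatest[OF assms(1), of "Poly_Mapping.keys f"] assms(2) by auto
  have lm: "lm gt f = m"
    by (rule lm_eqI[OF assms(1) m(1)]) (use m(2) in simp)
  show "lm gt f \<in> Poly_Mapping.keys f"
    unfolding lm by (rule m(1))
  show "v \<in> Poly_Mapping.keys f \<Longrightarrow> v \<noteq> lm gt f \<Longrightarrow> gt (lm gt f) v"
    unfolding lm using m(2) by simp
qed

lemma lc_nonzero: "admissible gt \<Longrightarrow> f \<noteq> 0 \<Longrightarrow> lc gt f \<noteq> 0"
  using lm_greatest_key(1)[of gt f] by (simp add: lc_def in_keys_iff)

lemma poly_mapping_sum_singles: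
  "p = (\<Sum>k\<in>Poly_Mapping.keys p. Poly_Mapping.single k (Poly_Mapping.lookup p k))"
  by (rule poly_mapping_eqI) (simp add: lookup_sum lookup_single when_def in_keys_iff)

lemma lookup_single_times_add:
  fixes f :: "('n, 'k::field) mpoly"
  shows "Poly_Mapping.lookup (Poly_Mapping.single v c * f) (v + u) = c * Poly_Mapping.lookup f u"
proof -
  have "Poly_Mapping.single v c * f =
      (\<Sum>k\<in>Poly_Mapping.keys f. Poly_Mapping.single (v + k) (c * Poly_Mapping.lookup f k))"
    using arg_cong[OF poly_mapping_sum_singles[of f], of "(*) (Poly_Mapping.single v c)"]
    by (simp add: sum_distrib_left mult_single)
  then show ?thesis
    by (simp add: lookup_sum lookup_single when_def in_keys_iff)
qed

lemma lm_monom_times: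
  fixes f :: "('n::{finite,linorder}, 'k::field) mpoly"
  assumes "admissible gt" "f \<noteq> 0"
  shows "lm gt (Poly_Mapping.single v 1 * f) = lm gt f + v"
proof (rule lm_eqI[OF assms(1)])
  show "lm gt f + v \<in> Poly_Mapping.keys (Poly_Mapping.single v 1 * f)"
    using lookup_single_times_add[of v 1 f "lm gt f"] lm_greatest_key(1)[OF assms]
    by (simp add: in_keys_iff add.commute)
next
  fix w assume "w \<in> Poly_Mapping.keys (Poly_Mapping.single v 1 * f)" and ne: "w \<noteq> lm gt f + v"
  then obtain u where "u \<in> Poly_Mapping.keys f" "w = u + v"
    using keys_mult[of "Poly_Mapping.single v 1" f] by (auto simp: add.commute)
  with ne show "gt (lm gt f + v) w"
    using lm_greatest_key(2)[OF assms] assms(1) by (auto simp: admissible_def)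
qed

section \<open>Linear combinations over the coefficient field\<close>

definition K_span :: "('n, 'k::field) mpoly set \<Rightarrow> ('n, 'k) mpoly set" where
  "K_span = module.span (\<lambda>c p. Poly_Mapping.single 0 c * p)"

lemma module_scalar_times:
  "module (\<lambda>c (p :: ('n, 'k::field) mpoly). Poly_Mapping.single 0 c * p)"
  by unfold_locales
    (simp_all add: distrib_left distrib_right single_add mult_single mult.assoc[symmetric])

lemmas K_span_explicit = module.span_explicit[OF module_scalar_times, folded K_span_def]
  and K_span_base = module.span_base[OF module_scalar_times, folded K_span_def]
  and K_span_zero = module.span_zero[OF module_scalar_times, folded K_span_def]
  and K_span_add = module.span_add[OF module_scalar_times, folded K_span_def]
  and K_span_scale = module.span_scale[OF module_scalar_times, folded K_span_def]
  and K_span_sum = module.span_sum[OF module_scalar_times, folded K_span_def]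

lemma K_span_single_timesI:
  assumes "Poly_Mapping.single v 1 * f \<in> K_span B"
  shows "Poly_Mapping.single v c * f \<in> K_span B"
  using K_span_scale[OF assms, of c] by (simp add: mult.assoc[symmetric] mult_single)

text \<open>
  Among the basis elements that occur with nonzero coefficient, the one with the largest leading
  monomial contributes the only term with that monomial, so this term survives in the sum.
\<close>

lemma lm_in_lm_of_K_span:
  assumes adm: "admissible gt" and B0: "0 \<notin> B" and inj: "inj_on (lm gt) B"
    and h: "h \<in> K_span B" "h \<noteq> 0"
  shows "lm gt h \<in> lm gt ` B"
proof -
  obtain T c where T: "finite T" "T \<subseteq> B" and hT: "h = (\<Sum>b\<in>T. Poly_Mapping.single 0 (c b) * b)"
    using h(1) unfolding K_span_explicit by blast
  define S where "S = {b \<in> T. c b \<noteq> 0}"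
  have S: "finite S" "S \<subseteq> B"
    using T by (auto simp: S_def)
  have hS: "h = (\<Sum>b\<in>S. Poly_Mapping.single 0 (c b) * b)"
    unfolding hT S_def by (rule sum.mono_neutral_right) (use T in auto)
  have lookup_h: "Poly_Mapping.lookup h u = (\<Sum>b\<in>S. c b * Poly_Mapping.lookup b u)" for u
    unfolding hS by (simp add: lookup_sum lookup_single_times_add[of 0 _ _ u, simplified])
  have "S \<noteq> {}"
    using h(2) hS by auto
  then obtain b where b: "b \<in> S" and "\<forall>x\<in>lm gt ` S. x \<noteq> lm gt b \<longrightarrow> gt (lm gt b) x"
    using admissible_has_greatest[OF adm, of "lm gt ` S"] S(1) by auto
  then have top: "gt (lm gt b) (lm gt a)" if "a \<in> S" "a \<noteq> b" for a
    using that b S(2) inj by (metis image_eqI inj_onD subsetD)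
  have key: "u = lm gt a \<or> gt (lm gt a) u" if "a \<in> S" "u \<in> Poly_Mapping.keys a" for a u
    using that S(2) B0 lm_greatest_key(2)[OF adm, of a u] by auto
  have "lm gt b \<notin> Poly_Mapping.keys a" if "a \<in> S" "a \<noteq> b" for a
    using key[OF that(1)] top[OF that] by (metis adm admissible_asym admissible_irrefl)
  then have "Poly_Mapping.lookup h (lm gt b) = (\<Sum>a\<in>S. if a = b then c b * lc gt b else 0)"
    unfolding lookup_h by (intro sum.cong) (auto simp: lc_def in_keys_iff)
  also have "\<dots> = c b * lc gt b"
    using b S(1) by simp
  also have "\<dots> \<noteq> 0"
  proof -
    have "b \<noteq> 0"
      using b S(2) B0 by auto
    with b show ?thesis
      using lc_nonzero[OF adm] by (simp add: S_def)
  qed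
  finally have "lm gt b \<in> Poly_Mapping.keys h"
    by (simp add: in_keys_iff)
  moreover have "gt (lm gt b) u" if "u \<in> Poly_Mapping.keys h" "u \<noteq> lm gt b" for u
  proof -
    have "\<exists>a\<in>S. u \<in> Poly_Mapping.keys a"
    proof (rule ccontr)
      assume "\<not> ?thesis"
      then have "Poly_Mapping.lookup h u = 0"
        unfolding lookup_h by (intro sum.neutral) (auto simp: in_keys_iff)
      with that(1) show False
        by (simp add: in_keys_iff)
    qed
    then obtain a where "a \<in> S" "u \<in> Poly_Mapping.keys a"
      by blast
    then show ?thesis
      using key[of a u] top[of a] that(2) adm by (metis admissible_def transpE)
  qed
  ultimately have "lm gt h = lm gt b"
    by (rule lm_eqI[OF adm])
  with b S(2) show ?thesis
    by blast
qed

section \<open>Multiplicative prolongations\<close>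

definition prolongations ::
    "('n monom \<Rightarrow> 'n monom \<Rightarrow> bool) \<Rightarrow> ('n monom \<Rightarrow> 'n monom set \<Rightarrow> 'n monom set) \<Rightarrow>
     ('n, 'k::field) mpoly set \<Rightarrow> ('n, 'k) mpoly set" where
  "prolongations gt L F =
     {Poly_Mapping.single v 1 * f |f v. f \<in> F \<and> v \<in> L (lm gt f) (lm gt ` F)}"

lemma lm_prolongation:
  fixes F :: "('n::{finite,linorder}, 'k::field) mpoly set"
  assumes "admissible gt" "autoreduced gt L F" "f \<in> F"
  shows "lm gt (Poly_Mapping.single v 1 * f) = lm gt f + v"
  using assms by (intro lm_monom_times) (auto simp: autoreduced_def)

lemma zero_notin_prolongations:
  fixes F :: "('n::{finite,linorder}, 'k::field) mpoly set"
  assumes "autoreduced gt L F"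
  shows "0 \<notin> prolongations gt L F"
proof
  assume "0 \<in> prolongations gt L F"
  then obtain f v where fv: "f \<in> F" "0 = Poly_Mapping.single v 1 * f"
    by (auto simp: prolongations_def)
  have "Poly_Mapping.lookup f u = 0" for u
    using lookup_single_times_add[of v 1 f u] by (simp flip: fv(2))
  then have "f = 0"
    by (intro poly_mapping_eqI) simp
  with fv assms show False
    by (simp add: autoreduced_def)
qed

text \<open>
  If \<open>lm(f) v = lm(g) w\<close>, the two cones meet, so by the defining property (b) of an involutive
  division one of \<open>lm(f)\<close>, \<open>lm(g)\<close> lies in the cone of the other; autoreducedness then forces
  \<open>f = g\<close>, and cancellation gives \<open>v = w\<close>.
\<close>

lemma inj_on_lm_prolongations:
  fixes F :: "('n::{finite,linorder}, 'k::field) mpoly set"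
  assumes adm: "admissible gt" and L: "involutive_division L" and F: "autoreduced gt L F"
  shows "inj_on (lm gt) (prolongations gt L F)"
proof (rule inj_onI)
  fix p q assume "p \<in> prolongations gt L F" "q \<in> prolongations gt L F" and eq: "lm gt p = lm gt q"
  then obtain f v g w where
    p: "p = Poly_Mapping.single v 1 * f" "f \<in> F" "v \<in> L (lm gt f) (lm gt ` F)" and
    q: "q = Poly_Mapping.single w 1 * g" "g \<in> F" "w \<in> L (lm gt g) (lm gt ` F)"
    unfolding prolongations_def by blast
  have lms: "lm gt f + v = lm gt g + w"
    using eq p q lm_prolongation[OF adm F] by simp
  have "lm gt f + v \<in> cone L (lm gt f) (lm gt ` F) \<inter> cone L (lm gt g) (lm gt ` F)"
    using p(3) q(3) lms unfolding cone_def by blast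
  then have "lm gt f \<in> cone L (lm gt g) (lm gt ` F) \<or> lm gt g \<in> cone L (lm gt f) (lm gt ` F)"
    using L F p(2) q(2) unfolding involutive_division_def autoreduced_def
    by (metis empty_iff finite_imageI imageI)
  then have "lm gt f = lm gt g"
    using F p(2) q(2) unfolding autoreduced_def autoreduced_monoms_def by (metis imageI)
  moreover from this have "f = g"
    using F p(2) q(2) by (auto simp: autoreduced_def dest: inj_onD)
  ultimately show "p = q"
    using lms p(1) q(1) by simp
qed

lemma reduces_to_zero_in_K_span:
  assumes "(L_reduction gt L F)\<^sup>*\<^sup>* p 0"
  shows "p \<in> K_span (prolongations gt L F)"
  using assms
proof (induction rule: converse_rtranclp_induct)
  case base
  show ?case by (rule K_span_zero)
next
  case (step p q)
  then obtain f v c where "f \<in> F" "v \<in> L (lm gt f) (lm gt ` F)"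
    and q: "q = p - Poly_Mapping.single v c * f"
    unfolding L_reduction_def by blast
  then have "Poly_Mapping.single v 1 * f \<in> prolongations gt L F"
    unfolding prolongations_def by blast
  then have "Poly_Mapping.single v c * f \<in> K_span (prolongations gt L F)"
    by (rule K_span_single_timesI[OF K_span_base])
  from K_span_add[OF step.IH this] show ?case
    by (simp add: q)
qed

text \<open>
  Expanding the polynomial coefficients into terms reduces the claim to the products \<open>f u\<close>, whose
  \<open>L\<close>-normal form is zero in an involutive basis.
\<close>

lemma ideal_subset_K_span:
  assumes NF: "normal_form_algorithm gt L NF" and F: "involutive_basis gt L NF F"
  shows "ideal F \<subseteq> K_span (prolongations gt L F)"
proof
  fix h assume "h \<in> ideal F"
  then show "h \<in> K_span (prolongations gt L F)"
    unfolding ideal_def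
  proof (induction rule: module.span_induct_alt[OF module_times, consumes 1])
    case 1
    show ?case by (rule K_span_zero)
  next
    case (2 c f h)
    have "Poly_Mapping.single u a * f \<in> K_span (prolongations gt L F)" for u a
    proof (rule K_span_single_timesI, rule reduces_to_zero_in_K_span)
      have "(L_reduction gt L F)\<^sup>*\<^sup>* (f * Poly_Mapping.single u 1)
          (NF (f * Poly_Mapping.single u 1) F)"
        using NF F by (auto simp: normal_form_algorithm_def involutive_basis_def)
      then show "(L_reduction gt L F)\<^sup>*\<^sup>* (Poly_Mapping.single u 1 * f) 0"
        using F \<open>f \<in> F\<close> by (simp add: involutive_basis_def mult.commute)
    qed
    then have "(\<Sum>u\<in>Poly_Mapping.keys c. Poly_Mapping.single u (Poly_Mapping.lookup c u)) * f
        \<in> K_span (prolongations gt L F)"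
      unfolding sum_distrib_right by (intro K_span_sum)
    then have "c * f \<in> K_span (prolongations gt L F)"
      by (simp flip: poly_mapping_sum_singles)
    then show ?case
      using \<open>h \<in> K_span _\<close> by (rule K_span_add)
  qed
qed

section \<open>Involutive bases are Groebner bases\<close>

theorem corollary7p2:
  fixes gt :: "('n::{finite,linorder}) monom \<Rightarrow> 'n monom \<Rightarrow> bool"
    and L :: "'n monom \<Rightarrow> 'n monom set \<Rightarrow> 'n monom set"
    and NF :: "('n, 'k::field_char_0) mpoly \<Rightarrow> ('n, 'k) mpoly set \<Rightarrow> ('n, 'k) mpoly"
    and F :: "('n, 'k) mpoly set"
  assumes "admissible gt"
    and "involutive_division L"
    and "normal_form_algorithm gt L NF"
    and "involutive_basis gt L NF F"
  shows "groebner_basis gt F (ideal F)"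
proof -
  interpret R: module "(*) :: ('n, 'k) mpoly \<Rightarrow> ('n, 'k) mpoly \<Rightarrow> ('n, 'k) mpoly"
    by (rule module_times)
  have auto: "autoreduced gt L F"
    using assms(4) by (simp add: involutive_basis_def)
  have F: "finite F" "0 \<notin> F"
    using auto by (auto simp: autoreduced_def)
  have sub: "F \<subseteq> ideal F"
    unfolding ideal_def by (rule R.span_superset)
  have "lt gt h \<in> ideal (lt gt ` (F - {0}))" if h: "h \<in> ideal F" "h \<noteq> 0" for h
  proof -
    have "h \<in> K_span (prolongations gt L F)"
      using ideal_subset_K_span[OF assms(3,4)] h(1) by blast
    then have "lm gt h \<in> lm gt ` prolongations gt L F"
      using zero_notin_prolongations[OF auto] inj_on_lm_prolongations[OF assms(1,2) auto] h(2)
      by (intro lm_in_lm_of_K_span[OF assms(1)])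
    then obtain f v where f: "f \<in> F" and "lm gt h = lm gt (Poly_Mapping.single v 1 * f)"
      unfolding prolongations_def by blast
    then have "lm gt h = lm gt f + v"
      using lm_prolongation[OF assms(1) auto] by simp
    moreover have "lc gt f \<noteq> 0"
    proof (rule lc_nonzero[OF assms(1)])
      show "f \<noteq> 0"
        using f F(2) by metis
    qed
    ultimately have lt_h: "lt gt h = Poly_Mapping.single v (lc gt h / lc gt f) * lt gt f"
      by (simp add: lt_def mult_single add.commute)
    have "lt gt f \<in> lt gt ` (F - {0})"
      using f F(2) by simp
    then show ?thesis
      unfolding ideal_def lt_h by (intro R.span_scale R.span_base)
  qed
  then have "lt gt ` (ideal F - {0}) \<subseteq> ideal (lt gt ` (F - {0}))"
    by blast
  then have "ideal (lt gt ` (ideal F - {0})) \<subseteq> ideal (lt gt ` (F - {0}))"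
    unfolding ideal_def by (rule R.span_minimal) (rule R.subspace_span)
  moreover have "ideal (lt gt ` (F - {0})) \<subseteq> ideal (lt gt ` (ideal F - {0}))"
    using sub unfolding ideal_def by (intro R.span_mono) blast
  ultimately show ?thesis
    using F(1) sub by (simp add: groebner_basis_def subset_antisym)
qed

end
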